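(* Let $n,t,\delta$ be integers with $n\ge 3$ and $2\le t\le \delta\le \left\lfloor \frac{n+t-3}{2}\right\rfloor$, let $\alpha\in[0,1)$, and let $h=\left\lfloor \frac{n+t-3}{2}\right\rfloor$. Put $$f_2(n,t,\delta,2)=\binom{n+t-\delta-2}{2}+(\delta-t+2)\delta,\qquad g_2(n,t,\delta,2)=\binom{n+t-h-2}{2}+(h-t+1)h+\delta,$$ and $h_2=\max\{f_2(n,t,\delta,2),\,g_2(n,t,\delta,2)\}$. Let $G$ be a finite, simple, connected graph of order $n$ with minimum degree $\delta$. If $$\lambda_\alpha(G)>\frac{\delta+\alpha n-\alpha\delta-1+\sqrt{(\delta+\alpha n-\alpha\delta-1)^2+4(1-\alpha)(2h_2-n\delta+\delta)}}{2},$$ then $G$ is one-to-one $t$-disjoint path coverable.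
   Context: The order of a graph is its number of vertices. For $\alpha\in[0,1)$, $A_\alpha(G)=\alpha D(G)+(1-\alpha)A(G)$, where $A(G)$ is the adjacency matrix and $D(G)$ the diagonal matrix of vertex degrees of $G$; the $\alpha$-spectral radius $\lambda_\alpha(G)$ is the largest eigenvalue of $A_\alpha(G)$. A graph $G$ is one-to-one $t$-disjoint path coverable if for any two distinct vertices $u,v$ of $G$ there exist $t$ distinct paths in $G$, each joining $u$ and $v$, such that every vertex of $G$ lies on at least one of the paths and any two of the paths have no common vertices other than $u$ and $v$. *)

theory Defs
  imports "Graph_Theory.Graph_Theory" "Jordan_Normal_Form.Char_Poly"
begin

text \<open>
  A finite simple graph is a digraph satisfying the locale \<open>graph\<close> of the library: finite, without
  loops or multiple arcs, and symmetric, so that each edge is represented by its two opposite arcs.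
  The degree of a vertex is therefore its \<open>out_degree\<close>.
\<close>

definition min_degree :: "('a, 'b) pre_digraph \<Rightarrow> nat" where
  "min_degree G = Min (out_degree G ` verts G)"

text \<open>
  Matrices are indexed by initial segments of the natural numbers, so an enumeration of the vertices
  has to be chosen; by \<open>eigenvalue_A_alpha_mat_iff\<close> below, the spectrum does not depend on it.
\<close>

definition vertex_list :: "('a, 'b) pre_digraph \<Rightarrow> 'a list" where
  "vertex_list G = (SOME vs. distinct vs \<and> set vs = verts G)"

definition adjacency_mat :: "('a, 'b) pre_digraph \<Rightarrow> real mat" where
  "adjacency_mat G = (let vs = vertex_list G in
     mat (length vs) (length vs) (\<lambda>(i, j). if vs ! i \<rightarrow>\<^bsub>G\<^esub> vs ! j then 1 else 0))"

definition degree_mat :: "('a, 'b) pre_digraph \<Rightarrow> real mat" where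
  "degree_mat G = (let vs = vertex_list G in
     mat (length vs) (length vs) (\<lambda>(i, j). if i = j then real (out_degree G (vs ! i)) else 0))"

definition A_alpha_mat :: "real \<Rightarrow> ('a, 'b) pre_digraph \<Rightarrow> real mat" where
  "A_alpha_mat \<alpha> G = \<alpha> \<cdot>\<^sub>m degree_mat G + (1 - \<alpha>) \<cdot>\<^sub>m adjacency_mat G"

text \<open>
  \<open>A_alpha_mat \<alpha> G\<close> is real symmetric, so all its complex eigenvalues are real and taking the
  maximum over the real ones is no restriction.
\<close>

definition alpha_spectral_radius :: "real \<Rightarrow> ('a, 'b) pre_digraph \<Rightarrow> real" where
  "alpha_spectral_radius \<alpha> G = Max {\<mu>. eigenvalue (A_alpha_mat \<alpha> G) \<mu>}"

definition one_to_one_disjoint_path_coverable :: "nat \<Rightarrow> ('a, 'b) pre_digraph \<Rightarrow> bool" where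
  "one_to_one_disjoint_path_coverable t G \<longleftrightarrow>
     (\<forall>u\<in>verts G. \<forall>v\<in>verts G. u \<noteq> v \<longrightarrow>
        (\<exists>P. finite P \<and> card P = t \<and>
             (\<forall>p\<in>P. vpath p G \<and> hd p = u \<and> last p = v) \<and>
             (\<forall>w\<in>verts G. \<exists>p\<in>P. w \<in> set p) \<and>
             (\<forall>p\<in>P. \<forall>q\<in>P. p \<noteq> q \<longrightarrow> set p \<inter> set q = {u, v})))"

text \<open>
  The truncated subtraction and the integer division below agree with the integer operations
  whenever \<open>n \<ge> 3\<close> and \<open>t \<le> \<delta> \<le> hbound n t\<close>.
\<close>

definition hbound :: "nat \<Rightarrow> nat \<Rightarrow> nat" where
  "hbound n t = (n + t - 3) div 2"

definition f2 :: "nat \<Rightarrow> nat \<Rightarrow> nat \<Rightarrow> nat" where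
  "f2 n t \<delta> = ((n + t - \<delta> - 2) choose 2) + (\<delta> - t + 2) * \<delta>"

definition g2 :: "nat \<Rightarrow> nat \<Rightarrow> nat \<Rightarrow> nat" where
  "g2 n t \<delta> = (let h = hbound n t in ((n + t - h - 2) choose 2) + (h - t + 1) * h + \<delta>)"

definition h2 :: "nat \<Rightarrow> nat \<Rightarrow> nat \<Rightarrow> nat" where
  "h2 n t \<delta> = max (f2 n t \<delta>) (g2 n t \<delta>)"

lemma vertex_list:
  assumes "finite (verts G)"
  shows "distinct (vertex_list G)" "set (vertex_list G) = verts G"
proof -
  have "\<exists>vs. distinct vs \<and> set vs = verts G"
    using finite_distinct_list[OF assms] by blast
  then have "distinct (vertex_list G) \<and> set (vertex_list G) = verts G"
    unfolding vertex_list_def by (rule someI_ex)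
  then show "distinct (vertex_list G)" "set (vertex_list G) = verts G"
    by auto
qed

lemma eigenvalue_A_alpha_mat_iff:
  assumes fin: "finite (verts G)"
  shows "eigenvalue (A_alpha_mat \<alpha> G) \<mu> \<longleftrightarrow>
    (\<exists>x. (\<exists>v\<in>verts G. x v \<noteq> 0) \<and>
         (\<forall>v\<in>verts G. \<alpha> * real (out_degree G v) * x v
            + (1 - \<alpha>) * (\<Sum>w\<in>verts G. (if v \<rightarrow>\<^bsub>G\<^esub> w then 1 else 0) * x w) = \<mu> * x v))"
proof -
  define vs where "vs = vertex_list G"
  define N where "N = length vs"
  have dist: "distinct vs" and set: "set vs = verts G"
    using vertex_list[OF fin] by (auto simp: vs_def)
  let ?M = "A_alpha_mat \<alpha> G"
  have carr: "?M \<in> carrier_mat N N"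
    by (auto simp: A_alpha_mat_def degree_mat_def adjacency_mat_def Let_def vs_def N_def)
  have bij: "bij_betw (\<lambda>i. vs ! i) {0..<N} (verts G)"
    using bij_betw_nth[OF dist, of "{0..<N}" "verts G"] set by (auto simp: N_def atLeast0LessThan)
  have row: "(?M *\<^sub>v vec N (\<lambda>i. x (vs ! i))) $ i
      = \<alpha> * real (out_degree G (vs ! i)) * x (vs ! i)
        + (1 - \<alpha>) * (\<Sum>w\<in>verts G. (if vs ! i \<rightarrow>\<^bsub>G\<^esub> w then 1 else 0) * x w)"
    if i: "i < N" for i and x :: "'a \<Rightarrow> real"
  proof -
    have "(?M *\<^sub>v vec N (\<lambda>i. x (vs ! i))) $ i
        = (\<Sum>j\<in>{0..<N}. ?M $$ (i, j) * x (vs ! j))"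
      using i carr by (auto simp: scalar_prod_def)
    also have "\<dots> = (\<Sum>j\<in>{0..<N}. (if j = i then \<alpha> * real (out_degree G (vs ! i)) * x (vs ! i) else 0)
          + (1 - \<alpha>) * ((if vs ! i \<rightarrow>\<^bsub>G\<^esub> vs ! j then 1 else 0) * x (vs ! j)))"
      using i
      by (intro sum.cong refl)
        (auto simp: A_alpha_mat_def degree_mat_def adjacency_mat_def Let_def
          vs_def[symmetric] N_def algebra_simps)
    also have "\<dots> = \<alpha> * real (out_degree G (vs ! i)) * x (vs ! i)
        + (1 - \<alpha>) * (\<Sum>j\<in>{0..<N}. (if vs ! i \<rightarrow>\<^bsub>G\<^esub> vs ! j then 1 else 0) * x (vs ! j))"
      using i by (simp add: sum.distrib sum_distrib_left)
    also have "(\<Sum>j\<in>{0..<N}. (if vs ! i \<rightarrow>\<^bsub>G\<^esub> vs ! j then 1 else 0) * x (vs ! j))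
        = (\<Sum>w\<in>verts G. (if vs ! i \<rightarrow>\<^bsub>G\<^esub> w then 1 else 0) * x w)"
      by (rule sum.reindex_bij_betw[OF bij])
    finally show ?thesis .
  qed
  have vec_form: "\<exists>x. y = vec N (\<lambda>i. x (vs ! i))" if "y \<in> carrier_vec N" for y :: "real vec"
  proof
    let ?x = "\<lambda>v. y $ (inv_into {0..<N} (\<lambda>i. vs ! i) v)"
    have "inv_into {0..<N} (\<lambda>i. vs ! i) (vs ! i) = i" if "i < N" for i
      using bij that by (auto simp: bij_betw_def intro: inv_into_f_f)
    then show "y = vec N (\<lambda>i. ?x (vs ! i))"
      using that by (intro eq_vecI) auto
  qed
  have ball: "(\<forall>v\<in>verts G. Q v) \<longleftrightarrow> (\<forall>i<N. Q (vs ! i))" for Q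
    unfolding set[symmetric] N_def by (rule all_set_conv_all_nth)
  have bex: "(\<exists>v\<in>verts G. Q v) \<longleftrightarrow> (\<exists>i<N. Q (vs ! i))" for Q
    using ball[of "\<lambda>v. \<not> Q v"] by blast
  have ev: "eigenvector ?M (vec N (\<lambda>i. x (vs ! i))) \<mu> \<longleftrightarrow>
      (\<exists>v\<in>verts G. x v \<noteq> 0) \<and>
      (\<forall>v\<in>verts G. \<alpha> * real (out_degree G v) * x v
         + (1 - \<alpha>) * (\<Sum>w\<in>verts G. (if v \<rightarrow>\<^bsub>G\<^esub> w then 1 else 0) * x w) = \<mu> * x v)"
    for x :: "'a \<Rightarrow> real"
  proof -
    have dim: "dim_row ?M = N" using carr by auto
    have "vec N (\<lambda>i. x (vs ! i)) \<noteq> 0\<^sub>v N \<longleftrightarrow> (\<exists>i<N. x (vs ! i) \<noteq> 0)"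
      by (auto simp: vec_eq_iff)
    moreover have "?M *\<^sub>v vec N (\<lambda>i. x (vs ! i)) = \<mu> \<cdot>\<^sub>v vec N (\<lambda>i. x (vs ! i)) \<longleftrightarrow>
        (\<forall>i<N. (?M *\<^sub>v vec N (\<lambda>i. x (vs ! i))) $ i = \<mu> * x (vs ! i))"
      unfolding vec_eq_iff using dim by (auto simp del: index_mult_mat_vec)
    ultimately show ?thesis
      unfolding eigenvector_def dim ball bex by (simp add: row del: index_mult_mat_vec)
  qed
  show ?thesis
    unfolding eigenvalue_def ev[symmetric]
    using vec_form carr by (metis carrier_matD(1) eigenvector_def)
qed

end

theory Submission
  imports Defs "Jordan_Normal_Form.Spectral_Radius"
begin

text \<open>
  A positive vector \<open>y\<close> with \<open>A\<^sub>\<alpha> y \<le> \<theta> y\<close> bounds all eigenvalues of \<open>A\<^sub>\<alpha>\<close> by \<open>\<theta>\<close>. Applied to the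
  degree vector plus a constant, this shows that the spectral hypothesis forces the degree sum
  above \<open>2 h\<^sub>2\<close>. If \<open>i - t + 2\<close> vertices had degree at most \<open>i\<close> for some \<open>i\<close> with
  \<open>\<delta> \<le> i \<le> (n + t - 3) / 2\<close>, the degree sum would be at most twice a convex quadratic function of
  \<open>i\<close> whose values at the two ends of this range are \<open>f\<^sub>2\<close> and \<open>g\<^sub>2\<close>. So low degrees are rare in the
  sense of Posa.

  For fixed ends \<open>u\<close> and \<open>v\<close>, coverability by \<open>t\<close> disjoint paths is stable under the Bondy--Chvatal
  closure with bound \<open>n + t - 2\<close>: if a path uses a new edge \<open>xy\<close> with
  \<open>d(x) + d(y) \<ge> n + t - 2\<close>, counting neighbours along the paths yields a rotation within that
  path or an exchange of tails with another path that avoids \<open>xy\<close>. When low degrees are rare, the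
  closure is complete: a nonadjacent pair \<open>x, y\<close> with maximal degree sum below the bound and
  \<open>d(x) \<le> d(y)\<close> would give too many vertices of degree at most \<open>d(x)\<close>, namely the non-neighbours
  of \<open>y\<close>.
\<close>

section \<open>Path covers and the Bondy--Chvatal closure\<close>

lemma not_successively_split:
  assumes "\<not> successively P w"
  obtains A a b B where "w = A @ a # b # B" "\<not> P a b"
proof -
  have "\<exists>A a b B. w = A @ a # b # B \<and> \<not> P a b"
    using assms
  proof (induction P w rule: successively.induct)
    case (3 P x y xs)
    show ?case
    proof (cases "P x y")
      case True
      with 3 obtain A a b B where "y # xs = A @ a # b # B" "\<not> P a b" by auto
      then have "x # y # xs = (x # A) @ a # b # B" by simp
      with \<open>\<not> P a b\<close> show ?thesis by blast
    next
      case False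
      then show ?thesis by (metis append_Nil)
    qed
  qed auto
  then show thesis using that by blast
qed

text \<open>Each of the \<open>length w - 1\<close> consecutive pairs contributes at most one to the
  left side: its first entry to the count for \<open>X\<close> or its second entry to the count for
  \<open>Y\<close>.\<close>

lemma successively_filter_count:
  assumes "successively (\<lambda>a b. \<not> (X a \<and> Y b)) w" "w \<noteq> []"
  shows "length (filter X (butlast w)) + length (filter Y (tl w)) < length w"
  using assms
proof (induction w)
  case (Cons a w)
  show ?case
  proof (cases w)
    case (Cons b w')
    then show ?thesis using Cons.IH Cons.prems by auto
  qed simp
qed simp

lemma hd_last_decomp:
  assumes "w \<noteq> []" "hd w = u" "last w = v" "u \<noteq> v"
  obtains L where "w = u # L @ [v]"
proof -
  from assms obtain w' where w: "w = u # w'" by (cases w) auto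
  with assms have "w' \<noteq> []" by auto
  then have "w' = butlast w' @ [v]" using assms w by (metis append_butlast_last_id last_ConsR)
  with w that show thesis by metis
qed

text \<open>
  A path from \<open>u\<close> to \<open>v\<close> is represented by the list of its interior vertices. As these lists form
  a set, at most one of them is empty, that is, the edge \<open>uv\<close> is used by at most one path.
\<close>

definition path_partition :: "'a set \<Rightarrow> 'a \<Rightarrow> 'a \<Rightarrow> 'a list set \<Rightarrow> bool" where
  "path_partition V u v I \<longleftrightarrow> finite I \<and> (\<forall>L\<in>I. distinct L) \<and>
     (\<forall>L\<in>I. \<forall>M\<in>I. L \<noteq> M \<longrightarrow> set L \<inter> set M = {}) \<and> (\<Union>L\<in>I. set L) = V - {u, v}"

definition path_cover :: "('a \<Rightarrow> 'a \<Rightarrow> bool) \<Rightarrow> 'a set \<Rightarrow> 'a \<Rightarrow> 'a \<Rightarrow> 'a list set \<Rightarrow> bool" where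
  "path_cover R V u v I \<longleftrightarrow>
     path_partition V u v I \<and> (\<forall>L\<in>I. successively R (u # L @ [v]))"

text \<open>The edge relation is a parameter because the closure argument varies the edges over a
  fixed vertex set.\<close>

definition rel_degree :: "('a \<Rightarrow> 'a \<Rightarrow> bool) \<Rightarrow> 'a set \<Rightarrow> 'a \<Rightarrow> nat" where
  "rel_degree R V x = card {w \<in> V. R x w}"

lemma path_partition_memD:
  assumes "path_partition V u v I" "L \<in> I"
  shows "distinct L" "set L \<inter> {u, v} = {}"
proof -
  have "set L \<subseteq> (\<Union>L\<in>I. set L)" using assms(2) by blast
  then have "set L \<subseteq> V - {u, v}" using assms(1) by (simp add: path_partition_def)
  then show "set L \<inter> {u, v} = {}" by blast
  show "distinct L" using assms by (simp add: path_partition_def)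
qed

lemma path_partition_sum_length:
  assumes I: "path_partition V u v I" and V: "finite V" "u \<in> V" "v \<in> V" "u \<noteq> v"
  shows "(\<Sum>L\<in>I. length L) + 2 = card V"
proof -
  have "(\<Sum>L\<in>I. length L) = (\<Sum>L\<in>I. card (set L))"
    using I by (intro sum.cong) (auto simp: path_partition_def distinct_card)
  also have "\<dots> = card (\<Union>L\<in>I. set L)"
    using I by (intro card_UN_disjoint[symmetric]) (auto simp: path_partition_def)
  also have "\<dots> = card (V - {u, v})" using I by (simp add: path_partition_def)
  also have "\<dots> + 2 = card V"
    using V card_mono[of V "{u, v}"] by (subst card_Diff_subset) auto
  finally show ?thesis .
qed

text \<open>The ends lie on every path and are counted separately; the interiors partition the other
  vertices. A degree thus splits into contributions of single paths.\<close>

lemma rel_degree_path_partition: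
  assumes I: "path_partition V u v I" and V: "finite V" "u \<in> V" "v \<in> V" "u \<noteq> v"
  shows "rel_degree R V x = of_bool (R x u) + of_bool (R x v) + (\<Sum>L\<in>I. length (filter (R x) L))"
proof -
  have "(\<Sum>L\<in>I. length (filter (R x) L)) = (\<Sum>L\<in>I. card {w \<in> set L. R x w})"
    using I by (intro sum.cong refl) (metis distinct_card distinct_filter path_partition_def set_filter)
  also have "\<dots> = card (\<Union>L\<in>I. {w \<in> set L. R x w})"
    using I by (intro card_UN_disjoint[symmetric]) (auto simp: path_partition_def)
  also have "(\<Union>L\<in>I. {w \<in> set L. R x w}) = {w \<in> (\<Union>L\<in>I. set L). R x w}" by auto
  also have "\<dots> = {w \<in> V - {u, v}. R x w}" using I by (simp add: path_partition_def)
  finally have eq: "(\<Sum>L\<in>I. length (filter (R x) L)) = card {w \<in> V - {u, v}. R x w}" .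
  have "{w \<in> V. R x w} =
      {w \<in> V - {u, v}. R x w} \<union> ((if R x u then {u} else {}) \<union> (if R x v then {v} else {}))"
    using V by auto
  also have "card \<dots> = card {w \<in> V - {u, v}. R x w}
      + card ((if R x u then {u} else {}) \<union> (if R x v then {v} else {}))"
    using V by (intro card_Un_disjoint) auto
  also have "card ((if R x u then {u} else {}) \<union> (if R x v then {v} else {}))
      = of_bool (R x u) + of_bool (R x v)"
    using V by simp
  finally show ?thesis unfolding rel_degree_def eq by simp
qed

section \<open>Replacing one or two paths\<close>

lemma path_partition_replace:
  assumes "path_partition V u v I" "L \<in> I" "distinct L'" "set L' = set L"
  shows "path_partition V u v (insert L' (I - {L})) \<and> card (insert L' (I - {L})) = card I"
proof -
  have fin: "finite I" and dis: "\<And>M. M \<in> I \<Longrightarrow> M \<noteq> L \<Longrightarrow> set L \<inter> set M = {}"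
    using assms by (auto simp: path_partition_def)
  \<comment> \<open>A list in \<open>I - {L}\<close> with the vertices of \<open>L\<close> would
    also be disjoint from \<open>L\<close>; both would then be empty and hence equal.\<close>
  have "L' \<notin> I - {L}"
    using dis assms(4) by (metis Diff_iff inf.idem insertI1 set_empty)
  then have "card (insert L' (I - {L})) = card I"
    using assms(2) fin by (metis card.insert card_Suc_Diff1 finite_Diff)
  moreover have "path_partition V u v (insert L' (I - {L}))"
  proof -
    have "(\<Union>M\<in>insert L' (I - {L}). set M) = (\<Union>M\<in>I. set M)" using assms by auto
    then have U: "(\<Union>M\<in>insert L' (I - {L}). set M) = V - {u, v}"
      using assms(1) by (simp add: path_partition_def)
    have "\<forall>M\<in>I - {L}. \<forall>N\<in>I - {L}. M \<noteq> N \<longrightarrow> set M \<inter> set N = {}"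
      using assms(1) by (simp add: path_partition_def)
    moreover have "set M \<inter> set L' = {}" if "M \<in> I - {L}" for M
      using dis[of M] that assms(4) by auto
    ultimately have "\<forall>M\<in>insert L' (I - {L}). \<forall>N\<in>insert L' (I - {L}). M \<noteq> N \<longrightarrow> set M \<inter> set N = {}"
      by (simp add: Int_commute)
    with U show ?thesis using assms(1,3) unfolding path_partition_def by simp
  qed
  ultimately show ?thesis by blast
qed

text \<open>Disjointness keeps a nonempty new list apart from the remaining ones, but says nothing
  about the empty list. The assumption \<open>empty\<close> prevents a new path from coinciding with
  an existing edge \<open>uv\<close>, which would lower the number of paths.\<close>

lemma path_partition_replace2:
  assumes I: "path_partition V u v I" "L \<in> I" "M \<in> I" "L \<noteq> M"
    and new: "distinct (L' @ M')" "set L' \<union> set M' = set L \<union> set M"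
    and empty: "[] \<in> I - {L, M} \<Longrightarrow> L' \<noteq> [] \<and> M' \<noteq> []"
  shows "path_partition V u v (insert L' (insert M' (I - {L, M})))
    \<and> card (insert L' (insert M' (I - {L, M}))) = card I"
proof -
  let ?J = "I - {L, M}"
  have fin: "finite I" using I by (simp add: path_partition_def)
  have dis: "set N \<inter> (set L \<union> set M) = {}" if "N \<in> ?J" for N
    using that I(1-3) by (simp add: path_partition_def Int_Un_distrib)
  have "L' \<notin> ?J" "M' \<notin> ?J"
    using dis[of L'] dis[of M'] empty new(2)
    by (metis Un_upper1 inf.absorb1 set_empty, metis Un_upper2 inf.absorb1 set_empty)
  \<comment> \<open>Equal disjoint lists are empty, so \<open>L\<close> and \<open>M\<close> would
    be empty too, hence equal.\<close>
  moreover have "L' \<noteq> M'"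
  proof
    assume "L' = M'"
    with new have "L' = []" "M' = []" by auto
    then show False using new I by auto
  qed
  moreover have "card I = Suc (Suc (card ?J))"
    using card_Diff_subset[of "{L, M}" I] card_mono[of I "{L, M}"] I fin by simp
  ultimately have "card (insert L' (insert M' ?J)) = card I"
    using fin by simp
  moreover have "path_partition V u v (insert L' (insert M' ?J))"
  proof -
    have "(\<Union>N\<in>insert L' (insert M' ?J). set N) = (set L' \<union> set M') \<union> (\<Union>N\<in>?J. set N)" by auto
    also have "\<dots> = (\<Union>N\<in>I. set N)" using new I by auto
    finally have U: "(\<Union>N\<in>insert L' (insert M' ?J). set N) = V - {u, v}"
      using I by (simp add: path_partition_def)
    have L': "set N \<inter> set L' = {}" "set N \<inter> set M' = {}" if "N \<in> ?J" for N
      using dis[OF that] new(2) by auto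
    have "\<forall>N\<in>?J. \<forall>N'\<in>?J. N \<noteq> N' \<longrightarrow> set N \<inter> set N' = {}"
      using I by (auto simp: path_partition_def)
    then have "\<forall>N\<in>insert L' (insert M' ?J). \<forall>N'\<in>insert L' (insert M' ?J). N \<noteq> N' \<longrightarrow> set N \<inter> set N' = {}"
      using L' new(1) by (simp add: Int_commute)
    moreover have "\<forall>N\<in>insert L' (insert M' ?J). distinct N" "finite (insert L' (insert M' ?J))"
      using I new(1) by (auto simp: path_partition_def)
    ultimately show ?thesis using U unfolding path_partition_def by blast
  qed
  ultimately show ?thesis by blast
qed

text \<open>The new path is given by its multiset of vertices, so a rotation is checked by
  rearranging lists. Only the other paths are assumed to be walks for \<open>R\<close>:
  \<open>L\<close> is the one that uses the missing edge.\<close>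

lemma path_cover_replace:
  assumes I: "path_partition V u v I" "L \<in> I" "\<And>M. M \<in> I - {L} \<Longrightarrow> successively R (u # M @ [v])"
    and uv: "u \<notin> set L" "v \<notin> set L" "u \<noteq> v"
    and w: "mset w = mset (u # L @ [v])" "hd w = u" "last w = v" "successively R w"
  shows "\<exists>J. path_cover R V u v J \<and> card J = card I"
proof -
  have "w \<noteq> []" using w(1) by auto
  with w uv obtain L' where w': "w = u # L' @ [v]" by (metis hd_last_decomp)
  with w(1) have m: "mset L' = mset L" by simp
  then have "set L' = set L" "distinct L'"
    using I by (auto simp: path_partition_def dest: mset_eq_setD mset_eq_imp_distinct_iff)
  note path_partition_replace[OF I(1,2) this(2,1)]
  moreover have "\<forall>N\<in>insert L' (I - {L}). successively R (u # N @ [v])"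
    using I(3) w(4) unfolding w' by blast
  ultimately show ?thesis unfolding path_cover_def by blast
qed

lemma path_cover_replace2:
  assumes I: "path_partition V u v I" "L \<in> I" "M \<in> I" "L \<noteq> M"
    "\<And>N. N \<in> I - {L, M} \<Longrightarrow> successively R (u # N @ [v])"
    and uv: "u \<noteq> v"
    and w: "mset w + mset z = mset (u # L @ [v]) + mset (u # M @ [v])"
      "w \<noteq> []" "hd w = u" "last w = v" "successively R w" "z \<noteq> []" "hd z = u" "last z = v" "successively R z"
    and empty: "[] \<in> I - {L, M} \<Longrightarrow> w \<noteq> [u, v] \<and> z \<noteq> [u, v]"
  shows "\<exists>J. path_cover R V u v J \<and> card J = card I"
proof -
  from w uv obtain L' M' where w': "w = u # L' @ [v]" "z = u # M' @ [v]" by (metis hd_last_decomp)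
  with w(1) have m: "mset (L' @ M') = mset (L @ M)" by simp
  then have "set (L' @ M') = set (L @ M)" by (rule mset_eq_setD)
  moreover have "distinct (L @ M)" using I by (auto simp: path_partition_def)
  then have "distinct (L' @ M')" using m by (metis mset_eq_imp_distinct_iff)
  moreover have "[] \<in> I - {L, M} \<Longrightarrow> L' \<noteq> [] \<and> M' \<noteq> []" using empty w' by auto
  ultimately have "path_partition V u v (insert L' (insert M' (I - {L, M})))
    \<and> card (insert L' (insert M' (I - {L, M}))) = card I"
    using I by (intro path_partition_replace2) auto
  moreover have "\<forall>N\<in>insert L' (insert M' (I - {L, M})). successively R (u # N @ [v])"
    using I(5) w(5,9) unfolding w' by blast
  ultimately show ?thesis unfolding path_cover_def by blast
qed

section \<open>Removing an edge from a cover\<close>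

text \<open>Only \<open>L0\<close> uses the missing edge \<open>xy\<close>. If no repair were
  possible, \<open>x\<close> and \<open>y\<close> would have few neighbours on each path: the
  absence of two kinds of rotation bounds them on \<open>L0\<close>, the absence of tail exchanges
  bounds them on the other paths, and the total falls short of \<open>deg\<close>.\<close>

lemma path_cover_crossing:
  assumes R: "symp R" "irreflp R" "\<not> R x y"
    and V: "finite V" "u \<in> V" "v \<in> V" "u \<noteq> v"
    and I: "path_partition V u v I" "L0 \<in> I" "2 \<le> card I"
    and L0: "u # L0 @ [v] = A @ x # y # B" "successively R (A @ [x])" "successively R (y # B)"
    and walks: "\<And>M. M \<in> I - {L0} \<Longrightarrow> successively R (u # M @ [v])"
    and deg: "card V + card I \<le> rel_degree R V x + rel_degree R V y + 2"
  shows "\<exists>J. path_cover R V u v J \<and> card J = card I"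
proof (rule ccontr)
  assume neg: "\<not> ?thesis"
  have sym: "R b a" if "R a b" for a b using R(1) that by (rule sympD)
  have R': "\<not> R y x" "\<not> R x x" "\<not> R y y" using R sym by (auto simp: irreflp_def)
  have rev: "successively R (rev L) \<longleftrightarrow> successively R L" for L
    using sym by (auto intro: successively_mono)
  have in_V: "set Q \<inter> {u, v} = {}" if "Q \<in> I" for Q
    using path_partition_memD[OF I(1) that] by blast
  have fin: "finite I" using I(1) by (simp add: path_partition_def)
  have hdA: "hd (A @ [x]) = u" and lastB: "last (y # B) = v"
    using arg_cong[OF L0(1), of hd] arg_cong[OF L0(1), of last] by (auto simp: hd_append split: if_splits)
  have no_single: False
    if "mset w = mset (u # L0 @ [v])" "hd w = u" "last w = v" "successively R w" for w
    using path_cover_replace[OF I(1,2) walks _ _ V(4) that] in_V[OF I(2)] neg by blast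
  have sX: "successively (\<lambda>a b. \<not> (R x a \<and> R y b)) (A @ [x])"
  proof (rule ccontr)
    assume "\<not> ?thesis"
    then obtain A1 a b A2 where A: "A @ [x] = A1 @ a # b # A2" and ab: "R x a" "R y b"
      by (rule not_successively_split) blast
    \<comment> \<open>From \<open>u\<close> to \<open>a\<close>, across to \<open>x\<close>, back
      along the path to \<open>b\<close>, across to \<open>y\<close> and on to
      \<open>v\<close>.\<close>
    define w where "w = (A1 @ [a]) @ rev (b # A2) @ y # B"
    have lx: "last (b # A2) = x" using arg_cong[OF A, of last] by simp
    have s: "successively R (A1 @ [a])" "successively R (b # A2)"
      using L0(2) unfolding A by (auto simp: successively_append_iff successively_Cons)
    have "mset w = mset ((A @ [x]) @ y # B)" unfolding w_def A by simp
    then have m: "mset w = mset (u # L0 @ [v])" unfolding L0(1) by simp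
    have "hd w = hd (A @ [x])" unfolding w_def A by (cases A1) auto
    moreover have "last w = v" using lastB by (simp add: w_def)
    moreover have "successively R w"
    proof -
      have "successively R (rev (b # A2) @ y # B)"
        using s(2) L0(3) ab(2) sym[of y b] rev[of "b # A2"]
        by (subst successively_append_iff) simp
      moreover have "hd (rev (b # A2) @ y # B) = x"
        using lx by (metis hd_append2 hd_rev list.distinct(1) rev_is_Nil_conv)
      ultimately show ?thesis
        unfolding w_def using s(1) sym[OF ab(1)] by (subst successively_append_iff) simp
    qed
    ultimately show False using no_single m hdA by simp
  qed
  have sY: "successively (\<lambda>a b. \<not> (R x a \<and> R y b)) (y # B)"
  proof (rule ccontr)
    assume "\<not> ?thesis"
    then obtain B1 a b B2 where B: "y # B = B1 @ a # b # B2" and ab: "R x a" "R y b"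
      by (rule not_successively_split) blast
    \<comment> \<open>From \<open>u\<close> to \<open>x\<close>, across to \<open>a\<close>, back
      along the path to \<open>y\<close>, across to \<open>b\<close> and on to
      \<open>v\<close>.\<close>
    define w where "w = (A @ [x]) @ rev (B1 @ [a]) @ b # B2"
    have hy: "hd (B1 @ [a]) = y" using arg_cong[OF B, of hd] by (cases B1) auto
    have s: "successively R (B1 @ [a])" "successively R (b # B2)"
      using L0(3) unfolding B by (auto simp: successively_append_iff successively_Cons)
    have "mset w = mset ((A @ [x]) @ y # B)" unfolding w_def B by simp
    then have m: "mset w = mset (u # L0 @ [v])" unfolding L0(1) by simp
    have "hd w = u" using hdA by (simp add: w_def hd_append split: if_splits)
    moreover have "last w = v" using lastB unfolding w_def B by simp
    moreover have "successively R w"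
    proof -
      have "last (rev (B1 @ [a])) = y" using hy by (metis last_rev)
      then have "successively R (rev (B1 @ [a]) @ b # B2)"
        using s ab(2) rev[of "B1 @ [a]"]
        by (subst successively_append_iff) simp
      then show ?thesis
        unfolding w_def using L0(2) ab(1) by (subst successively_append_iff) simp
    qed
    ultimately show False using no_single m by simp
  qed
  \<comment> \<open>Of the adjacencies to the ends, only \<open>xu\<close> and \<open>yv\<close> are
    counted here; \<open>yu\<close> and \<open>xv\<close> are left to \<open>bound2\<close>.\<close>
  have bound0: "of_bool (R x u) + of_bool (R y v)
      + length (filter (R x) L0) + length (filter (R y) L0) \<le> length L0"
  proof -
    have "butlast (u # L0 @ [v]) = A @ [x] @ butlast (y # B)" unfolding L0(1) by (simp add: butlast_append)
    then have "filter (R x) (u # L0) = filter (R x) (butlast (A @ [x])) @ filter (R x) (butlast (y # B))"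
      using R' by (simp only: butlast.simps butlast_snoc filter_append append_Cons[symmetric]) simp
    moreover have "tl (u # L0 @ [v]) = tl (A @ [x]) @ y # B" unfolding L0(1) by (cases A) auto
    then have "filter (R y) (L0 @ [v]) = filter (R y) (tl (A @ [x])) @ filter (R y) (tl (y # B))"
      using R' by simp
    ultimately have "length (filter (R x) (u # L0)) + length (filter (R y) (L0 @ [v]))
        = (length (filter (R x) (butlast (A @ [x]))) + length (filter (R y) (tl (A @ [x]))))
        + (length (filter (R x) (butlast (y # B))) + length (filter (R y) (tl (y # B))))"
      by simp
    moreover have "length (u # L0 @ [v]) = length (A @ [x]) + length (y # B)" unfolding L0(1) by simp
    moreover have "length (filter (R x) (u # L0)) = of_bool (R x u) + length (filter (R x) L0)"
      "length (filter (R y) (L0 @ [v])) = of_bool (R y v) + length (filter (R y) L0)"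
      by simp_all
    moreover have "length (filter (R x) (butlast (A @ [x]))) + length (filter (R y) (tl (A @ [x])))
        < length (A @ [x])"
      "length (filter (R x) (butlast (y # B))) + length (filter (R y) (tl (y # B))) < length (y # B)"
      using successively_filter_count[OF sX] successively_filter_count[OF sY] by blast+
    moreover have "length (u # L0 @ [v]) = length L0 + 2" by simp
    ultimately show ?thesis by linarith
  qed
  \<comment> \<open>Exchange of tails: one new walk passes from \<open>x\<close> to
    \<open>b\<close>, the other from \<open>a\<close> to \<open>y\<close>. With
    \<open>b \<noteq> v\<close> and \<open>a \<noteq> u\<close>, neither of them is the single edge
    \<open>uv\<close>.\<close>
  have cross: False
    if Q: "Q \<in> I" "Q \<noteq> L0" "u # Q @ [v] = C @ a # b # D" and ab: "R y a" "R x b"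
      and ne: "[] \<in> I - {L0, Q} \<Longrightarrow> b \<noteq> v \<and> a \<noteq> u" for Q C a b D
  proof -
    have "hd (C @ [a]) = u" "last (b # D) = v"
      using arg_cong[OF Q(3), of hd] arg_cong[OF Q(3), of last] by (auto simp: hd_append split: if_splits)
    moreover have "successively R (C @ [a])" "successively R (b # D)"
      using walks[of Q] Q unfolding Q(3) by (auto simp: successively_append_iff successively_Cons)
    ultimately have CD: "hd (C @ [a]) = u" "last (b # D) = v" "successively R (C @ [a])" "successively R (b # D)"
      by blast+
    have "successively R ((A @ [x]) @ b # D)" "successively R ((C @ [a]) @ y # B)"
      using CD(3,4) L0(2,3) ab sym[of y a] by (simp_all add: successively_append_iff)
    moreover have "hd ((A @ [x]) @ b # D) = u" "hd ((C @ [a]) @ y # B) = u"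
      using hdA CD(1) by (simp_all only: hd_append2 snoc_eq_iff_butlast not_False_eq_True append_is_Nil_conv list.distinct simp_thms)
    moreover have "last ((A @ [x]) @ b # D) = v" "last ((C @ [a]) @ y # B) = v"
      using lastB CD(2) by simp_all
    moreover have "mset ((A @ [x]) @ b # D) + mset ((C @ [a]) @ y # B)
        = mset (u # L0 @ [v]) + mset (u # Q @ [v])"
      unfolding L0(1) Q(3) by simp
    moreover have "(A @ [x]) @ b # D \<noteq> [u, v] \<and> (C @ [a]) @ y # B \<noteq> [u, v]" if "[] \<in> I - {L0, Q}"
    proof -
      have "b \<noteq> v" "a \<noteq> u" using ne[OF that] by auto
      then show ?thesis by (auto simp: append_eq_Cons_conv)
    qed
    ultimately have "\<exists>J. path_cover R V u v J \<and> card J = card I"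
      using Q V(4) I(1,2) walks
      by (intro path_cover_replace2[of V u v I L0 Q R "(A @ [x]) @ b # D" "(C @ [a]) @ y # B"]) auto
    with neg show False by blast
  qed
  \<comment> \<open>Inside \<open>Q\<close> an exchange never produces the edge \<open>uv\<close>,
    so \<open>cross\<close> applies to every path. Counting pairs gives at most
    \<open>length Q - 1\<close>, but omits the last vertex for \<open>y\<close> and the first for
    \<open>x\<close>.\<close>
  have bound1: "length (filter (R x) Q) + length (filter (R y) Q) \<le> length Q + of_bool (Q \<noteq> [])"
    if Q: "Q \<in> I" "Q \<noteq> L0" for Q
  proof (cases "Q = []")
    case False
    have "successively (\<lambda>a b. \<not> (R y a \<and> R x b)) Q"
    proof (rule ccontr)
      assume "\<not> ?thesis"
      then obtain C a b D where C: "Q = C @ a # b # D" and ab: "R y a" "R x b"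
        by (rule not_successively_split) blast
      have "u # Q @ [v] = (u # C) @ a # b # (D @ [v])" using C by simp
      from cross[OF Q this ab] show False using in_V[OF Q(1)] C by auto
    qed
    from successively_filter_count[OF this False] False
    have "length (filter (R y) (butlast Q)) + length (filter (R x) (tl Q)) < length Q" by simp
    moreover have "length (filter (R y) Q) \<le> length (filter (R y) (butlast Q)) + 1"
      using False by (cases Q rule: rev_cases) auto
    moreover have "length (filter (R x) Q) \<le> length (filter (R x) (tl Q)) + 1"
      using False by (cases Q) auto
    ultimately show ?thesis using False by simp
  qed simp
  text \<open>
    Exchanging tails could produce the single edge \<open>uv\<close>, which must not already be another path. If
    \<open>uv\<close> is another path, it is chosen as \<open>Q\<close>; only for \<open>Q\<close> are the ends \<open>u\<close> and \<open>v\<close> taken into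
    account.
  \<close>
  have "\<exists>Q\<in>I - {L0}. [] \<notin> I - {L0, Q}"
  proof (cases "[] \<in> I - {L0}")
    case False
    have "card (I - {L0}) \<noteq> 0" using I(2,3) fin by simp
    then have "I - {L0} \<noteq> {}" by force
    then show ?thesis using False by auto
  qed auto
  then obtain Q where Q: "Q \<in> I" "Q \<noteq> L0" and Qe: "[] \<notin> I - {L0, Q}" by blast
  \<comment> \<open>The pairs now run over the whole walk with its \<open>length Q + 2\<close>
    vertices, so the two adjacencies to the ends fit into the bound of \<open>bound1\<close> for
    nonempty \<open>Q\<close>.\<close>
  have bound2: "of_bool (R y u) + of_bool (R x v)
      + length (filter (R x) Q) + length (filter (R y) Q) \<le> length Q + 1"
  proof -
    have "successively (\<lambda>a b. \<not> (R y a \<and> R x b)) (u # Q @ [v])"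
    proof (rule ccontr)
      assume "\<not> ?thesis"
      then obtain C a b D where C: "u # Q @ [v] = C @ a # b # D" and ab: "R y a" "R x b"
        by (rule not_successively_split) blast
      from cross[OF Q this] Qe show False by blast
    qed
    from successively_filter_count[OF this] show ?thesis
      by (auto simp: butlast_append split: if_splits)
  qed
  let ?J = "I - {L0, Q}"
  let ?f = "\<lambda>M. length (filter (R x) M) + length (filter (R y) M)"
  have split: "sum g I = g L0 + g Q + sum g ?J" for g :: "'a list \<Rightarrow> nat"
  proof -
    have "I = insert L0 (insert Q ?J)" using Q I(2) by auto
    then have "sum g I = sum g (insert L0 (insert Q ?J))" by simp
    then show ?thesis using Q fin by simp
  qed
  have "sum ?f ?J \<le> (\<Sum>M\<in>?J. length M + 1)"
    using bound1 by (intro sum_mono) (fastforce simp: of_bool_def split: if_splits)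
  also have "\<dots> = sum length ?J + card ?J" by (simp add: sum.distrib del: add_Suc_right One_nat_def)
  finally have "sum ?f ?J \<le> sum length ?J + card ?J" .
  moreover have "card I = card ?J + 2" using split[of "\<lambda>_. 1"] by simp
  moreover have "sum ?f I = (\<Sum>L\<in>I. length (filter (R x) L)) + (\<Sum>L\<in>I. length (filter (R y) L))"
    by (rule sum.distrib)
  \<comment> \<open>The bounds sum to \<open>card V - 2\<close> plus one for each path other than
    \<open>L0\<close>, that is \<open>card V + card I - 3\<close>, one less than \<open>deg\<close>
    requires.\<close>
  ultimately show False
    using deg bound0 bound2 split[of ?f] split[of length] path_partition_sum_length[OF I(1) V]
    unfolding rel_degree_path_partition[OF I(1) V] by simp
qed

text \<open>At most one path uses \<open>xy\<close>: two such paths would share \<open>x\<close> and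
  \<open>y\<close>, so \<open>{x, y} = {u, v}\<close> and both interiors would be empty, hence
  equal. If one does, \<open>path_cover_crossing\<close> applies with the ends of the edge named
  \<open>a\<close>, \<open>b\<close> in the order of traversal.\<close>

lemma path_cover_drop_edge:
  assumes R: "symp R" "irreflp R" and xy: "x \<noteq> y" "\<not> R x y"
    and V: "finite V" "u \<in> V" "v \<in> V" "u \<noteq> v"
    and I: "path_cover (\<lambda>a b. R a b \<or> {a, b} = {x, y}) V u v I" "2 \<le> card I"
    and deg: "card V + card I \<le> rel_degree R V x + rel_degree R V y + 2"
  shows "\<exists>J. path_cover R V u v J \<and> card J = card I"
proof (cases "path_cover R V u v I")
  case False
  define R' where "R' = (\<lambda>a b. R a b \<or> {a, b} = {x, y})"
  have "path_cover R' V u v I" using I(1) unfolding R'_def .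
  then have part: "path_partition V u v I" and walks: "\<And>M. M \<in> I \<Longrightarrow> successively R' (u # M @ [v])"
    by (auto simp: path_cover_def)
  have in_V: "set Q \<inter> {u, v} = {}" and distQ: "distinct Q" if "Q \<in> I" for Q
    using path_partition_memD[OF part that] by blast+
  obtain L0 where L0: "L0 \<in> I" "\<not> successively R (u # L0 @ [v])"
    using False part by (auto simp: path_cover_def)
  then obtain A a b B where AB: "u # L0 @ [v] = A @ a # b # B" "\<not> R a b"
    by (elim not_successively_split)
  have "R' a b" using walks[OF L0(1)] unfolding AB(1) by (auto simp: successively_append_iff)
  with AB(2) have ab: "{a, b} = {x, y}" unfolding R'_def by blast
  have dist: "distinct (A @ a # b # B)"
    using in_V[OF L0(1)] distQ[OF L0(1)] V(4) unfolding AB(1)[symmetric] by auto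
  have R'R: "successively R L" if "successively R' L" "\<not> {a, b} \<subseteq> set L" for L
  proof (rule successively_mono[OF that(1)])
    fix c d assume "c \<in> set L" "d \<in> set L" "R' c d"
    moreover from this have "{c, d} \<noteq> {a, b}" using that(2) by (metis empty_subsetI insert_subset)
    ultimately show "R c d" using ab unfolding R'_def by simp
  qed
  have "successively R' ((A @ [a]) @ b # B)" using walks[OF L0(1)] unfolding AB(1) by simp
  then have "successively R' (A @ [a])" "successively R' (b # B)"
    unfolding successively_append_iff[of _ "A @ [a]"] by blast+
  then have "successively R (A @ [a])" "successively R (b # B)"
    using dist by (auto intro!: R'R simp del: successively.simps)
  moreover have "successively R (u # M @ [v])" if M: "M \<in> I - {L0}" for M
  proof (rule ccontr)
    assume "\<not> ?thesis"
    then obtain C c d D where CD: "u # M @ [v] = C @ c # d # D" "\<not> R c d"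
      by (elim not_successively_split)
    have "R' c d" using walks[of M] M unfolding CD(1) by (auto simp: successively_append_iff)
    with CD(2) ab have cd: "{c, d} = {a, b}" unfolding R'_def by simp
    have endpoints: "Q = []"
      if "Q \<in> I" "u # Q @ [v] = E @ e # f # F" "e \<in> {u, v}" "f \<in> {u, v}" for Q E e f F
    proof -
      have d: "distinct (E @ e # f # F)"
        using in_V[OF that(1)] distQ[OF that(1)] V(4) unfolding that(2)[symmetric] by auto
      have "E = []"
      proof (rule ccontr)
        assume "E \<noteq> []"
        then have "u \<in> set E" using arg_cong[OF that(2), of hd] by (cases E) auto
        with d that(3,4) show False by auto
      qed
      moreover have "F = []"
      proof (rule ccontr)
        assume "F \<noteq> []"
        then have "v \<in> set F" using arg_cong[OF that(2), of last] by (auto split: if_splits)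
        with d that(3,4) show False by auto
      qed
      ultimately show ?thesis using that(2) by simp
    qed
    have "set L0 \<inter> set M = {}" using M L0(1) part unfolding path_partition_def by blast
    moreover have "{a, b} \<subseteq> set (u # L0 @ [v])" unfolding AB(1) by auto
    moreover have "{c, d} \<subseteq> set (u # M @ [v])" unfolding CD(1) by auto
    ultimately have "{a, b} \<subseteq> {u, v}" using cd by auto
    moreover from this have "{c, d} \<subseteq> {u, v}" using cd by simp
    ultimately have "L0 = []" "M = []"
      using endpoints[OF L0(1) AB(1)] endpoints[OF _ CD(1)] M by auto
    then show False using M by simp
  qed
  moreover have "\<not> R a b" by fact
  moreover have "card V + card I \<le> rel_degree R V a + rel_degree R V b + 2"
    using deg ab by (auto simp: doubleton_eq_iff)
  ultimately show ?thesis
    using path_cover_crossing[OF R _ V part L0(1) I(2) AB(1)] by blast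
qed (use I in auto)

section \<open>Covers when low degrees are rare\<close>

text \<open>Take \<open>t - 1\<close> paths with one interior vertex each and one path through all
  the rest. As \<open>t < card V\<close>, there are enough vertices; if none is left over, the last
  path is the edge \<open>uv\<close>.\<close>

lemma path_cover_complete:
  assumes V: "finite V" "u \<in> V" "v \<in> V" "u \<noteq> v" and t: "1 \<le> t" "t < card V"
    and R: "\<And>a b. a \<in> V \<Longrightarrow> b \<in> V \<Longrightarrow> a \<noteq> b \<Longrightarrow> R a b"
  shows "\<exists>I. path_cover R V u v I \<and> card I = t"
proof -
  obtain ws where ws: "distinct ws" "set ws = V - {u, v}"
    using V(1) by (metis finite_Diff finite_distinct_list)
  have "card (V - {u, v}) = card V - 2" using V by (subst card_Diff_subset) auto
  then have len: "length ws = card V - 2" using ws by (metis distinct_card)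
  let ?as = "take (t - 1) ws" and ?L = "drop (t - 1) ws"
  let ?S = "(\<lambda>w. [w]) ` set ?as"
  have tl: "t - 1 \<le> length ws" using t len by simp
  have dis: "set ?as \<inter> set ?L = {}" using ws(1) by (simp add: set_take_disj_set_drop_if_distinct)
  have un: "set ?as \<union> set ?L = V - {u, v}"
    using ws(2) by (metis append_take_drop_id set_append)
  have "?L \<notin> ?S" using dis by auto
  moreover have "card ?S = t - 1"
    using ws(1) tl by (subst card_image) (auto simp: inj_on_def distinct_card)
  ultimately have "card (insert ?L ?S) = t" using t by simp
  moreover have "path_cover R V u v (insert ?L ?S)"
    unfolding path_cover_def
  proof
    have "(\<Union>M\<in>insert ?L ?S. set M) = V - {u, v}" using un by auto
    moreover have "\<forall>M\<in>insert ?L ?S. \<forall>N\<in>insert ?L ?S. M \<noteq> N \<longrightarrow> set M \<inter> set N = {}"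
      using dis by auto
    ultimately show "path_partition V u v (insert ?L ?S)"
      using ws(1) unfolding path_partition_def by simp
    have R': "successively R zs" if "distinct zs" "set zs \<subseteq> V" for zs
      using that by (induction zs rule: induct_list012) (auto intro: R)
    have "distinct (u # M @ [v]) \<and> set (u # M @ [v]) \<subseteq> V" if M: "M \<in> insert ?L ?S" for M
    proof -
      have "distinct M" using M ws(1) by auto
      moreover have "set M \<subseteq> set ?as \<union> set ?L" using M by auto
      then have "set M \<subseteq> V - {u, v}" unfolding un .
      ultimately show ?thesis using V by auto
    qed
    then show "\<forall>M\<in>insert ?L ?S. successively R (u # M @ [v])"
      using R' by blast
  qed
  ultimately show ?thesis by blast
qed

text \<open>Induction on the number of nonadjacent ordered pairs. Adding edges preserves
  \<open>rare\<close>, since degrees only grow. Its existence premise restricts \<open>i\<close> to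
  values not below the minimum degree; for smaller \<open>i\<close> the count is zero and the
  inequality can fail.\<close>

lemma path_cover_if_low_degrees_rare:
  fixes R :: "'a \<Rightarrow> 'a \<Rightarrow> bool"
  assumes R: "symp R" "irreflp R"
    and V: "finite V" "u \<in> V" "v \<in> V" "u \<noteq> v" and t: "2 \<le> t" "t < card V"
    and rare: "\<And>i. \<exists>w\<in>V. rel_degree R V w \<le> i \<Longrightarrow> 2 * i + 3 \<le> card V + t
      \<Longrightarrow> card {w \<in> V. rel_degree R V w \<le> i} + t < i + 2"
  shows "\<exists>I. path_cover R V u v I \<and> card I = t"
  using R rare
proof (induction "card {(a, b) \<in> V \<times> V. a \<noteq> b \<and> \<not> R a b}" arbitrary: R rule: less_induct)
  case (less R)
  let ?d = "rel_degree R V"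
  let ?N = "{(a, b) \<in> V \<times> V. a \<noteq> b \<and> \<not> R a b}"
  have finN: "finite ?N" by (rule finite_subset[of _ "V \<times> V"]) (use V in auto)
  show ?case
  proof (cases "?N = {}")
    case True
    then show ?thesis using t by (intro path_cover_complete[OF V]) auto
  next
    case False
    obtain p where p: "p \<in> ?N" "\<And>q. q \<in> ?N \<Longrightarrow> ?d (fst q) + ?d (snd q) \<le> ?d (fst p) + ?d (snd p)"
      using obtains_MAX[OF finN False, of "\<lambda>q. ?d (fst q) + ?d (snd q)"] finN
      by (metis (no_types, lifting) Max_ge finite_imageI image_eqI)
    have sym: "R b a" if "R a b" for a b using less.prems(1) that by (rule sympD)
    obtain x y where xy: "(x, y) \<in> ?N" "?d x \<le> ?d y"
      and max: "\<And>a b. (a, b) \<in> ?N \<Longrightarrow> ?d a + ?d b \<le> ?d x + ?d y"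
    proof (cases "?d (fst p) \<le> ?d (snd p)")
      case True
      with that[of "fst p" "snd p"] p show thesis by fastforce
    next
      case False
      with that[of "snd p" "fst p"] p sym show thesis by (fastforce simp: add.commute)
    qed
    show ?thesis
    proof (cases "card V + t \<le> ?d x + ?d y + 2")
      case True
      let ?R' = "\<lambda>a b. R a b \<or> {a, b} = {x, y}"
      have "{(a, b) \<in> V \<times> V. a \<noteq> b \<and> \<not> ?R' a b} \<subseteq> ?N - {(x, y)}" by auto
      moreover have "?N - {(x, y)} \<subset> ?N" using xy by auto
      ultimately have "card {(a, b) \<in> V \<times> V. a \<noteq> b \<and> \<not> ?R' a b} < card ?N"
        using finN by (intro psubset_card_mono) auto
      moreover have "symp ?R'" using sym by (auto intro!: sympI)
      moreover have "irreflp ?R'" using less.prems(2) xy by (auto simp: irreflp_def)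
      moreover have "card {w \<in> V. rel_degree ?R' V w \<le> i} + t < i + 2"
        if i: "\<exists>w\<in>V. rel_degree ?R' V w \<le> i" "2 * i + 3 \<le> card V + t" for i
      proof -
        have mono: "?d w \<le> rel_degree ?R' V w" for w
          unfolding rel_degree_def using V(1) by (intro card_mono) auto
        have "card {w \<in> V. rel_degree ?R' V w \<le> i} \<le> card {w \<in> V. ?d w \<le> i}"
          using V(1) mono by (intro card_mono) (auto intro: order_trans)
        moreover have "\<exists>w\<in>V. ?d w \<le> i" using i(1) mono order_trans by blast
        ultimately show ?thesis using less.prems(3)[OF _ i(2)] by linarith
      qed
      ultimately obtain I where I: "path_cover ?R' V u v I" "card I = t"
        using less.hyps[of ?R'] by blast
      then show ?thesis
        using path_cover_drop_edge[OF less.prems(1,2) _ _ V I(1)] xy t True by auto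
    next
      case False
      then have le: "2 * ?d x + 3 \<le> card V + t" using xy(2) by simp
      let ?A = "{w \<in> V. R y w}" and ?B = "{w \<in> V. w \<noteq> y \<and> \<not> R y w}"
      have "V = insert y (?A \<union> ?B)" "y \<notin> ?A \<union> ?B" "?A \<inter> ?B = {}"
        using xy less.prems(2) by (auto simp: irreflp_def)
      then have "card V = Suc (card ?A + card ?B)"
        using V(1) by (metis (no_types, lifting) card_Un_disjoint card_insert_disjoint finite_Un finite_insert)
      then have cV: "card V = Suc (?d y + card ?B)" by (simp add: rel_degree_def)
      \<comment> \<open>A non-neighbour \<open>w\<close> of \<open>y\<close> yields the pair
        \<open>(w, y)\<close>, whose degree sum is at most that of \<open>(x, y)\<close>.\<close>
      have "?B \<subseteq> {w \<in> V. ?d w \<le> ?d x}"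
      proof
        fix w assume "w \<in> ?B"
        then have "(w, y) \<in> ?N" using xy sym by auto
        from max[OF this] show "w \<in> {w \<in> V. ?d w \<le> ?d x}" using \<open>w \<in> ?B\<close> by auto
      qed
      then have "card ?B \<le> card {w \<in> V. ?d w \<le> ?d x}" using V(1) by (intro card_mono) auto
      moreover have "card {w \<in> V. ?d w \<le> ?d x} + t < ?d x + 2"
        using xy by (intro less.prems(3)[OF _ le]) auto
      \<comment> \<open>Since \<open>card ?B = card V - 1 - ?d y\<close>, this gives
        \<open>card V + t < ?d x + ?d y + 3\<close>, against the case assumption.\<close>
      ultimately show ?thesis using False cV by linarith
    qed
  qed
qed

section \<open>Degree sums\<close>

lemma sum_of_bool_card: "finite S \<Longrightarrow> (\<Sum>w\<in>S. of_bool (P w)) = of_nat (card {w \<in> S. P w})"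
  by (simp add: Collect_conj_eq)

text \<open>Let \<open>T = V - S\<close>. Edges between \<open>S\<close> and \<open>T\<close> are
  charged to their ends in \<open>S\<close>, which doubles the sum over \<open>S\<close>; edges
  inside \<open>T\<close> contribute at most \<open>|T| (|T| - 1)\<close>.\<close>

lemma sum_rel_degree_le:
  assumes R: "symp R" "irreflp R" and V: "finite V" "S \<subseteq> V"
  shows "(\<Sum>v\<in>V. rel_degree R V v) \<le>
    2 * (\<Sum>v\<in>S. rel_degree R V v) + (card V - card S) * (card V - card S - 1)"
proof -
  have sym: "R b a \<longleftrightarrow> R a b" for a b using R(1) by (auto dest: sympD)
  have finS: "finite S" using V by (rule finite_subset[rotated])
  let ?T = "V - S"
  have cT: "card ?T = card V - card S" using V finS by (simp add: card_Diff_subset)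
  have dsum: "rel_degree R V v = (\<Sum>w\<in>S. of_bool (R v w)) + card {w \<in> ?T. R v w}" for v
  proof -
    have "{w \<in> V. R v w} = {w \<in> S. R v w} \<union> {w \<in> ?T. R v w}" using V by auto
    then have "rel_degree R V v = card {w \<in> S. R v w} + card {w \<in> ?T. R v w}"
      unfolding rel_degree_def using V finS by (simp add: card_Un_disjoint disjoint_iff)
    moreover have "card {w \<in> S. R v w} = (\<Sum>w\<in>S. of_bool (R v w))"
      using finS by (simp only: sum_of_bool_card of_nat_id)
    ultimately show ?thesis by simp
  qed
  have "card {w \<in> ?T. R v w} \<le> card ?T - 1" if "v \<in> ?T" for v
  proof -
    have "{w \<in> ?T. R v w} \<subseteq> ?T - {v}" using R(2) by (auto simp: irreflp_def)
    then have "card {w \<in> ?T. R v w} \<le> card (?T - {v})" using V by (intro card_mono) auto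
    then show ?thesis using V that by simp
  qed
  then have "(\<Sum>v\<in>?T. card {w \<in> ?T. R v w}) \<le> card ?T * (card ?T - 1)"
    using sum_bounded_above[of ?T "\<lambda>v. card {w \<in> ?T. R v w}" "card ?T - 1"] by simp
  moreover have "(\<Sum>v\<in>?T. \<Sum>w\<in>S. of_bool (R v w)) \<le> (\<Sum>w\<in>S. rel_degree R V w)"
  proof -
    have "(\<Sum>v\<in>?T. \<Sum>w\<in>S. of_bool (R v w)) = (\<Sum>w\<in>S. \<Sum>v\<in>?T. of_bool (R w v) :: nat)"
      by (subst sum.swap) (simp add: sym)
    also have "\<dots> = (\<Sum>w\<in>S. card {v \<in> ?T. R w v})"
      using V by (intro sum.cong refl) (simp only: sum_of_bool_card finite_Diff of_nat_id)
    also have "\<dots> \<le> (\<Sum>w\<in>S. rel_degree R V w)"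
      unfolding rel_degree_def using V by (intro sum_mono card_mono) auto
    finally show ?thesis .
  qed
  moreover have "(\<Sum>v\<in>?T. rel_degree R V v)
      = (\<Sum>v\<in>?T. \<Sum>w\<in>S. of_bool (R v w)) + (\<Sum>v\<in>?T. card {w \<in> ?T. R v w})"
    unfolding dsum by (rule sum.distrib)
  moreover have "(\<Sum>v\<in>V. rel_degree R V v) = (\<Sum>v\<in>?T. rel_degree R V v) + (\<Sum>v\<in>S. rel_degree R V v)"
    using V by (rule sum.subset_diff[rotated])
  ultimately show ?thesis unfolding cT by linarith
qed

lemma double_choose_two: "2 * (m choose 2) = m * (m - 1)"
proof -
  have "even (m * (m - 1))" by (cases m) auto
  then show ?thesis by (simp only: choose_two dvd_mult_div_cancel)
qed

text \<open>Convexity: if the chord from \<open>x\<close> to \<open>h\<close> falls, so does the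
  chord from \<open>l\<close> to \<open>x\<close>. The case distinction is on the slope
  \<open>a * (h + x) + b\<close> of the first chord.\<close>

lemma quadratic_le_max_endpoints:
  fixes a b c x l h :: int
  assumes "0 \<le> a" "l \<le> x" "x \<le> h"
  shows "a * x\<^sup>2 + b * x + c \<le> max (a * l\<^sup>2 + b * l + c) (a * h\<^sup>2 + b * h + c)"
proof (cases "0 \<le> a * (h + x) + b")
  case True
  then have "0 \<le> (h - x) * (a * (h + x) + b)" using assms by simp
  also have "\<dots> = (a * h\<^sup>2 + b * h + c) - (a * x\<^sup>2 + b * x + c)"
    by (simp add: algebra_simps power2_eq_square)
  finally show ?thesis by (intro max.coboundedI2) linarith
next
  case False
  have "a * (l + x) \<le> a * (h + x)" using assms by (intro mult_left_mono) auto
  then have "0 \<le> (x - l) * - (a * (l + x) + b)"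
    using False assms by (intro mult_nonneg_nonneg) auto
  also have "\<dots> = (a * l\<^sup>2 + b * l + c) - (a * x\<^sup>2 + b * x + c)"
    by (simp add: algebra_simps power2_eq_square)
  finally show ?thesis by (intro max.coboundedI1) linarith
qed

section \<open>Eigenvalue bounds\<close>

text \<open>A Collatz-Wielandt argument: the eigenvalue equation is compared with the inequality for
  \<open>y\<close> at a vertex where \<open>|x v| / y v\<close> is maximal.\<close>

lemma eigenvalue_le_if_positive_supersolution:
  fixes M :: "'a \<Rightarrow> 'a \<Rightarrow> real"
  assumes V: "finite V" "\<And>v w. v \<in> V \<Longrightarrow> w \<in> V \<Longrightarrow> 0 \<le> M v w"
    and y: "\<And>v. v \<in> V \<Longrightarrow> 0 < y v" "\<And>v. v \<in> V \<Longrightarrow> (\<Sum>w\<in>V. M v w * y w) \<le> \<theta> * y v"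
    and x: "\<exists>v\<in>V. x v \<noteq> 0" "\<And>v. v \<in> V \<Longrightarrow> (\<Sum>w\<in>V. M v w * x w) = \<mu> * x v"
  shows "\<mu> \<le> \<theta>"
proof -
  let ?r = "\<lambda>v. \<bar>x v\<bar> / y v"
  have "V \<noteq> {}" using x(1) by auto
  then obtain v where "v \<in> V" "?r v = (MAX w\<in>V. ?r w)"
    using obtains_MAX[OF V(1), of ?r] by metis
  then have v: "v \<in> V" "\<And>w. w \<in> V \<Longrightarrow> ?r w \<le> ?r v"
    using V(1) by simp_all
  obtain z where z: "z \<in> V" "x z \<noteq> 0" using x(1) by auto
  then have "0 < ?r z" using y(1) by simp
  then have "0 < ?r v" using v(2)[OF z(1)] by linarith
  then have pos: "0 < \<bar>x v\<bar>" by (metis abs_ge_zero div_0 less_eq_real_def less_irrefl)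
  have bd: "\<bar>x w\<bar> \<le> ?r v * y w" if "w \<in> V" for w
    using v(2)[OF that] y(1)[OF that] by (simp add: pos_divide_le_eq)
  have "\<mu> * \<bar>x v\<bar> \<le> \<bar>\<mu> * x v\<bar>" by (simp add: abs_mult mult_right_mono)
  also have "\<dots> = \<bar>\<Sum>w\<in>V. M v w * x w\<bar>" using x(2)[OF v(1)] by simp
  also have "\<dots> \<le> (\<Sum>w\<in>V. \<bar>M v w * x w\<bar>)" by (rule sum_abs)
  also have "\<dots> \<le> (\<Sum>w\<in>V. M v w * (?r v * y w))"
  proof (rule sum_mono)
    fix w assume w: "w \<in> V"
    have "\<bar>M v w * x w\<bar> = M v w * \<bar>x w\<bar>" using V(2)[OF v(1) w] by (simp add: abs_mult)
    then show "\<bar>M v w * x w\<bar> \<le> M v w * (?r v * y w)"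
      using mult_left_mono[OF bd[OF w] V(2)[OF v(1) w]] by simp
  qed
  also have "\<dots> = ?r v * (\<Sum>w\<in>V. M v w * y w)" by (simp add: sum_distrib_left mult_ac)
  also have "\<dots> \<le> ?r v * (\<theta> * y v)" using \<open>0 < ?r v\<close> y(2)[OF v(1)] by (intro mult_left_mono) auto
  also have "\<dots> = \<theta> * \<bar>x v\<bar>" using y(1)[OF v(1)] by simp
  finally show ?thesis using pos by simp
qed

text \<open>Bounds the eigenvalues through the degree sum. \<open>K\<close> may be any upper bound,
  so that \<open>2 * h2\<close> can later take the place of the degree sum.\<close>

lemma A_alpha_eigenvalue_le:
  fixes \<alpha> c K \<mu> :: real and x :: "'a \<Rightarrow> real"
  defines "\<theta> \<equiv> (c + sqrt (c\<^sup>2 + 4 * K)) / 2"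
  assumes R: "symp R" "irreflp R" and V: "finite V"
    and \<delta>: "0 < \<delta>" "\<And>v. v \<in> V \<Longrightarrow> \<delta> \<le> rel_degree R V v"
    and \<alpha>: "0 \<le> \<alpha>" "\<alpha> < 1"
    and c: "c = real \<delta> + \<alpha> * real (card V) - \<alpha> * real \<delta> - 1"
    and K: "(1 - \<alpha>) * (real (\<Sum>v\<in>V. rel_degree R V v) - real (card V) * real \<delta> + real \<delta>) \<le> K"
    and x: "\<exists>v\<in>V. x v \<noteq> 0"
    and eig: "\<And>v. v \<in> V \<Longrightarrow> \<alpha> * real (rel_degree R V v) * x v
      + (1 - \<alpha>) * (\<Sum>w\<in>V. of_bool (R v w) * x w) = \<mu> * x v"
  shows "\<mu> \<le> \<theta>"
proof -
  let ?d = "\<lambda>v. real (rel_degree R V v)"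
  let ?n = "real (card V)" and ?D = "\<Sum>v\<in>V. real (rel_degree R V v)"
  have "?n * real \<delta> \<le> ?D"
    using sum_bounded_below[of V "real \<delta>" ?d] \<delta>(2) by simp
  then have "0 \<le> (1 - \<alpha>) * (?D - ?n * real \<delta> + real \<delta>)" using \<alpha> by simp
  then have K0: "0 \<le> K" using K by simp
  text \<open>
    \<open>\<theta>\<close> is the larger root of \<open>X\<^sup>2 - c X - K\<close>. The row sums of \<open>M\<^sup>2 - c M\<close> are at most \<open>K\<close>, so the
    vector \<open>M 1 + s 1\<close>, whose entries are \<open>d v + s\<close>, is a supersolution for \<open>\<theta>\<close>.
  \<close>
  define s where "s = \<theta> - c"
  have "\<bar>c\<bar> \<le> sqrt (c\<^sup>2 + 4 * K)" using K0 by (simp add: real_le_rsqrt)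
  then have s0: "0 \<le> s" unfolding s_def \<theta>_def by (simp add: field_simps)
  have "(sqrt (c\<^sup>2 + 4 * K))\<^sup>2 = c\<^sup>2 + 4 * K" using K0 by simp
  \<comment> \<open>The other root is \<open>- s\<close>, and the product of the two roots is
    \<open>- K\<close>.\<close>
  then have Ks: "K = \<theta> * s" unfolding s_def \<theta>_def by (simp add: field_simps power2_eq_square)
  define M where "M v w = (if v = w then \<alpha> * ?d v else 0) + (1 - \<alpha>) * of_bool (R v w)" for v w
  have Msum: "(\<Sum>w\<in>V. M v w * y w) = \<alpha> * ?d v * y v + (1 - \<alpha>) * (\<Sum>w\<in>V. of_bool (R v w) * y w)"
    if "v \<in> V" for v y
  proof -
    have "(\<Sum>w\<in>V. M v w * y w) = (\<Sum>w\<in>V. (if v = w then \<alpha> * ?d v * y v else 0) + (1 - \<alpha>) * (of_bool (R v w) * y w))"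
      by (intro sum.cong refl) (simp add: M_def algebra_simps)
    also have "\<dots> = (\<Sum>w\<in>V. if v = w then \<alpha> * ?d v * y v else 0) + (1 - \<alpha>) * (\<Sum>w\<in>V. of_bool (R v w) * y w)"
      by (simp only: sum.distrib sum_distrib_left)
    also have "(\<Sum>w\<in>V. if v = w then \<alpha> * ?d v * y v else 0) = \<alpha> * ?d v * y v"
      using V that by simp
    finally show ?thesis .
  qed
  have degsum: "(\<Sum>w\<in>V. of_bool (R v w)) = ?d v" if "v \<in> V" for v
    using V by (simp only: sum_of_bool_card rel_degree_def)
  \<comment> \<open>From the degree sum, remove the degree of \<open>v\<close> and those of the
    \<open>?n - 1 - ?d v\<close> other non-neighbours, each at least \<delta>.\<close>
  have nbr: "(\<Sum>w\<in>V. of_bool (R v w) * ?d w) \<le> ?D - ?d v - (?n - 1 - ?d v) * real \<delta>" if v: "v \<in> V" for v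
  proof -
    have "?D - (\<Sum>w\<in>V. of_bool (R v w) * ?d w) = (\<Sum>w\<in>V. (1 - of_bool (R v w)) * ?d w)"
      by (simp add: sum_subtractf left_diff_distrib)
    also have "\<dots> \<ge> (\<Sum>w\<in>V. (1 - of_bool (R v w)) * real \<delta> + (if w = v then ?d v - real \<delta> else 0))"
      using \<delta>(2) R(2) by (intro sum_mono) (auto simp: irreflp_def)
    moreover have "(\<Sum>w\<in>V. (1 - of_bool (R v w)) * real \<delta> + (if w = v then ?d v - real \<delta> else 0))
        = (?n - ?d v) * real \<delta> + (?d v - real \<delta>)"
      using V v degsum[OF v] by (simp add: sum.distrib sum_subtractf flip: sum_distrib_right)
    ultimately show ?thesis by (simp add: algebra_simps)
  qed
  show ?thesis
  proof (rule eigenvalue_le_if_positive_supersolution[where V = V and M = M and x = x and y = "\<lambda>v. ?d v + s"])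
    fix v assume v: "v \<in> V"
    show "0 < ?d v + s" using \<delta>(1) \<delta>(2)[OF v] s0 by simp
    show "(\<Sum>w\<in>V. M v w * x w) = \<mu> * x v" using Msum eig v by simp
    have dn: "?d v \<le> ?n - 1"
    proof -
      have "{w \<in> V. R v w} \<subset> V" using R(2) v by (auto simp: irreflp_def)
      then have "rel_degree R V v < card V" unfolding rel_degree_def using V by (rule psubset_card_mono[rotated])
      then show ?thesis by simp
    qed
    have "(\<Sum>w\<in>V. of_bool (R v w) * (?d w + s)) = (\<Sum>w\<in>V. of_bool (R v w) * ?d w) + s * ?d v"
      using degsum[OF v] by (simp add: distrib_left sum.distrib mult.commute flip: sum_distrib_left sum_distrib_right)
    then have "(\<Sum>w\<in>V. M v w * (?d w + s))
        = \<alpha> * ?d v * (?d v + s) + (1 - \<alpha>) * ((\<Sum>w\<in>V. of_bool (R v w) * ?d w) + s * ?d v)"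
      using Msum[OF v, of "\<lambda>w. ?d w + s"] by simp
    also have "\<dots> \<le> \<alpha> * ?d v * (?d v + s)
        + (1 - \<alpha>) * ((?D - ?d v - (?n - 1 - ?d v) * real \<delta>) + s * ?d v)"
      using nbr[OF v] \<alpha> by (intro add_left_mono mult_left_mono) auto
    also have "\<dots> = \<alpha> * ?d v * ?d v + s * ?d v + (1 - \<alpha>) * (real \<delta> - 1) * ?d v
        + (1 - \<alpha>) * (?D - ?n * real \<delta> + real \<delta>)"
      by (simp add: algebra_simps)
    \<comment> \<open>Bounding only one factor of the square by \<open>?n - 1\<close> makes the
      coefficient of \<open>?d v\<close> exactly \<open>c + s\<close>.\<close>
    also have "\<dots> \<le> \<alpha> * ?d v * (?n - 1) + s * ?d v + (1 - \<alpha>) * (real \<delta> - 1) * ?d v + K"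
      using K dn \<alpha> by (intro add_mono order_refl mult_left_mono) auto
    also have "\<dots> = (c + s) * ?d v + \<theta> * s"
      unfolding Ks c by (simp add: algebra_simps)
    also have "\<dots> = \<theta> * (?d v + s)" by (simp add: s_def algebra_simps)
    finally show "(\<Sum>w\<in>V. M v w * (?d w + s)) \<le> \<theta> * (?d v + s)" .
  qed (use V \<alpha> x in \<open>auto simp: M_def\<close>)
qed

section \<open>Existence and finiteness of real eigenvalues\<close>

text \<open>Ensures that the maximum defining \<open>alpha_spectral_radius\<close> is over a
  nonempty set. A complex eigenvalue exists; symmetry makes it real, and then the real or the
  imaginary part of its eigenvector is a real eigenvector.\<close>

lemma real_symmetric_mat_has_eigenvalue:
  fixes A :: "real mat"
  assumes A: "A \<in> carrier_mat n n" "0 < n"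
    and sym: "\<And>i j. i < n \<Longrightarrow> j < n \<Longrightarrow> A $$ (i, j) = A $$ (j, i)"
  shows "\<exists>\<mu>. eigenvalue A \<mu>"
proof -
  let ?A = "map_mat complex_of_real A"
  have cA: "?A \<in> carrier_mat n n" using A by simp
  obtain k where "eigenvalue ?A k"
    using spectrum_non_empty[OF cA A(2)] by (auto simp: spectrum_def)
  then obtain z where z: "z \<in> carrier_vec n" "z \<noteq> 0\<^sub>v n" "?A *\<^sub>v z = k \<cdot>\<^sub>v z"
    using cA by (auto simp: eigenvalue_def eigenvector_def)
  define p q where "p i = Re (z $ i)" and "q i = Im (z $ i)" for i
  have row: "(\<Sum>j<n. complex_of_real (A $$ (i, j)) * z $ j) = k * z $ i" if "i < n" for i
  proof -
    have "(\<Sum>j<n. complex_of_real (A $$ (i, j)) * z $ j) = (?A *\<^sub>v z) $ i"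
      using A z(1) that by (simp add: scalar_prod_def atLeast0LessThan)
    then show ?thesis using z that by simp
  qed
  have rowp: "(\<Sum>j<n. A $$ (i, j) * p j) = Re k * p i - Im k * q i"
    and rowq: "(\<Sum>j<n. A $$ (i, j) * q j) = Re k * q i + Im k * p i" if "i < n" for i
    using arg_cong[OF row[OF that], of Re] arg_cong[OF row[OF that], of Im]
    by (simp_all add: p_def q_def)
  \<comment> \<open>By symmetry the bilinear form of \<open>A\<close> takes the same value at
    \<open>(p, q)\<close> and \<open>(q, p)\<close>; evaluating both sides by the eigenvalue
    equations isolates \<open>Im k\<close>.\<close>
  have "(\<Sum>i<n. \<Sum>j<n. A $$ (i, j) * p j * q i) = (\<Sum>i<n. \<Sum>j<n. A $$ (i, j) * q j * p i)"
    by (subst sum.swap) (auto intro!: sum.cong simp: sym)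
  moreover have "(\<Sum>i<n. \<Sum>j<n. A $$ (i, j) * p j * q i) = (\<Sum>i<n. (Re k * p i - Im k * q i) * q i)"
    by (intro sum.cong refl) (simp add: rowp flip: sum_distrib_right)
  moreover have "(\<Sum>i<n. \<Sum>j<n. A $$ (i, j) * q j * p i) = (\<Sum>i<n. (Re k * q i + Im k * p i) * p i)"
    by (intro sum.cong refl) (simp add: rowq flip: sum_distrib_right)
  ultimately have "(\<Sum>i<n. (Re k * q i + Im k * p i) * p i - (Re k * p i - Im k * q i) * q i) = 0"
    by (simp add: sum_subtractf)
  then have "Im k * (\<Sum>i<n. (p i)\<^sup>2 + (q i)\<^sup>2) = 0"
    by (simp add: sum_distrib_left algebra_simps power2_eq_square)
  moreover obtain i where i: "i < n" "z $ i \<noteq> 0" using z by (auto simp: vec_eq_iff)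
  have "(\<Sum>i<n. (p i)\<^sup>2 + (q i)\<^sup>2) \<noteq> 0"
  proof
    assume "(\<Sum>i<n. (p i)\<^sup>2 + (q i)\<^sup>2) = 0"
    then have "(p i)\<^sup>2 + (q i)\<^sup>2 = 0"
      using i(1) by (subst (asm) sum_nonneg_eq_0_iff) auto
    then show False using i(2) by (simp add: p_def q_def complex_eq_iff)
  qed
  ultimately have k: "Im k = 0" by simp
  have ev: "eigenvalue A (Re k)" if "\<And>i. i < n \<Longrightarrow> (\<Sum>j<n. A $$ (i, j) * r j) = Re k * r i"
    and "r i \<noteq> 0" for r
  proof -
    have "A *\<^sub>v vec n r = Re k \<cdot>\<^sub>v vec n r"
      using A that(1) by (intro eq_vecI) (auto simp: scalar_prod_def atLeast0LessThan)
    moreover have "vec n r \<noteq> 0\<^sub>v n" using that(2) i(1) by (auto simp: vec_eq_iff)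
    ultimately show ?thesis using A unfolding eigenvalue_def eigenvector_def
      by (intro exI[of _ "vec n r"]) auto
  qed
  have "p i \<noteq> 0 \<or> q i \<noteq> 0" using i(2) by (simp add: p_def q_def complex_eq_iff)
  then show ?thesis using ev[of p] ev[of q] rowp rowq k by auto
qed

lemma finite_eigenvalues:
  fixes A :: "'a :: field mat"
  assumes "A \<in> carrier_mat n n"
  shows "finite {\<mu>. eigenvalue A \<mu>}"
  using card_finite_spectrum(1)[OF assms] by (simp add: spectrum_def)

section \<open>The spectral condition\<close>

text \<open>The set of low-degree vertices is chosen to contain \<open>v0\<close>, which contributes
  \<delta> rather than \<open>i\<close> to the degree sum; hence the separate summand \<delta> in
  \<open>g2\<close>.\<close>

lemma low_degrees_rare:
  assumes R: "symp R" "irreflp R" and V: "finite V" "card V = n"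
    and t: "2 \<le> t" "t \<le> \<delta>"
    and \<delta>: "\<And>v. v \<in> V \<Longrightarrow> \<delta> \<le> rel_degree R V v" "v0 \<in> V" "rel_degree R V v0 = \<delta>"
    and many: "2 * h2 n t \<delta> < (\<Sum>v\<in>V. rel_degree R V v)"
    and i: "\<exists>w\<in>V. rel_degree R V w \<le> i" "2 * i + 3 \<le> n + t"
  shows "card {w \<in> V. rel_degree R V w \<le> i} + t < i + 2"
proof (rule ccontr)
  let ?d = "rel_degree R V" and ?L = "{w \<in> V. rel_degree R V w \<le> i}"
  assume "\<not> ?thesis"
  then have L: "i + 2 - t \<le> card ?L" by simp
  have \<delta>i: "\<delta> \<le> i" using i(1) \<delta>(1) order_trans by blast
  have "v0 \<in> ?L" using \<delta>(2,3) \<delta>i by simp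
  then have "i + 1 - t \<le> card (?L - {v0})" using L V(1) by simp
  then obtain S0 where S0: "S0 \<subseteq> ?L - {v0}" "card S0 = i + 1 - t" "finite S0"
    by (rule obtain_subset_with_card_n)
  let ?S = "insert v0 S0"
  have S: "?S \<subseteq> V" "card ?S = i + 2 - t"
    using S0 \<delta>(2) t \<delta>i by (auto simp: card_insert_if)
  have "(\<Sum>v\<in>S0. ?d v) \<le> card S0 * i"
    using sum_bounded_above[of S0 ?d i] S0(1) by auto
  moreover have "(\<Sum>v\<in>?S. ?d v) = \<delta> + (\<Sum>v\<in>S0. ?d v)"
    using S0 \<delta>(3) by (subst sum.insert) auto
  ultimately have sumS: "(\<Sum>v\<in>?S. ?d v) \<le> \<delta> + (i - t + 1) * i"
    using S0(2) t \<delta>i by (simp add: Suc_diff_le)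
  \<comment> \<open>This is \<open>g2\<close> at \<open>j = hbound n t\<close>; at
    \<open>j = \<delta>\<close> the last two summands merge into
    \<open>(\<delta> - t + 2) * \<delta>\<close>, which gives \<open>f2\<close>.\<close>
  define g where "g j = ((n + t - j - 2) choose 2) + (j - t + 1) * j + \<delta>" for j
  have "n - card ?S = n + t - i - 2" using S(2) t \<delta>i by simp
  then have "(\<Sum>v\<in>V. ?d v) \<le> 2 * (\<delta> + (i - t + 1) * i) + 2 * ((n + t - i - 2) choose 2)"
    using sum_rel_degree_le[OF R V(1) S(1)] sumS V(2) double_choose_two[of "n + t - i - 2"] by simp
  then have le_g: "(\<Sum>v\<in>V. ?d v) \<le> 2 * g i" by (simp add: g_def)
  define a where "a = int n + int t - 2"
  \<comment> \<open>Doubling avoids the division in the binomial coefficient, and the bounds on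
    \<open>j\<close> make the truncated subtractions exact. The leading coefficient 3 gives
    convexity.\<close>
  have g: "int (2 * g j) = 3 * (int j)\<^sup>2 + (3 - 2 * a - 2 * int t) * int j + (a\<^sup>2 - a + 2 * int \<delta>)"
    if j: "t \<le> j" "j + 2 \<le> n + t" for j
  proof -
    obtain m where m: "n + t = m + j + 2" using j by (metis add.assoc add.commute le_Suc_ex)
    obtain l where l: "j = t + l" using j le_Suc_ex by blast
    have "int (2 * (m choose 2)) = int m * (int m - 1)"
      unfolding double_choose_two by (cases m) (auto simp: algebra_simps)
    moreover have "int m = a - int j" using m by (simp add: a_def)
    ultimately have "int (2 * (m choose 2)) = (a - int j) * (a - int j - 1)" by simp
    moreover have "n + t - j - 2 = m" using m by simp
    moreover have "int ((j - t + 1) * j) = (int j - int t + 1) * int j" using l by (simp add: algebra_simps)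
    ultimately have "int (2 * g j) = (a - int j) * (a - int j - 1) + 2 * ((int j - int t + 1) * int j) + 2 * int \<delta>"
      by (simp add: g_def)
    then show ?thesis by (simp add: algebra_simps power2_eq_square)
  qed
  have h: "i \<le> hbound n t" "hbound n t + 2 \<le> n + t" using i(2) by (auto simp: hbound_def)
  have "int (2 * g i) \<le> max (int (2 * g \<delta>)) (int (2 * g (hbound n t)))"
    using quadratic_le_max_endpoints[of 3 "int \<delta>" "int i" "int (hbound n t)"] g[of i] g[of \<delta>]
      g[of "hbound n t"] t \<delta>i h by simp
  then have "g i \<le> max (g \<delta>) (g (hbound n t))" by simp
  moreover have "g \<delta> = f2 n t \<delta>" using t by (simp add: g_def f2_def)
  moreover have "g (hbound n t) = g2 n t \<delta>" by (simp add: g_def g2_def Let_def)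
  ultimately have "g i \<le> h2 n t \<delta>" by (simp add: h2_def)
  then show False using many le_g by linarith
qed

section \<open>Translation between relations and digraphs\<close>

text \<open>Without multiple arcs, an arc leaving \<open>v\<close> is determined by its
  head.\<close>

lemma (in graph) out_degree_eq_rel_degree:
  "out_degree G v = rel_degree (\<lambda>a b. a \<rightarrow>\<^bsub>G\<^esub> b) (verts G) v"
proof -
  have "bij_betw (head G) (out_arcs G v) {w \<in> verts G. v \<rightarrow>\<^bsub>G\<^esub> w}"
    unfolding bij_betw_def
  proof
    show "inj_on (head G) (out_arcs G v)"
      by (intro inj_onI no_multi_arcs) (auto simp: arc_to_ends_def)
    show "head G ` out_arcs G v = {w \<in> verts G. v \<rightarrow>\<^bsub>G\<^esub> w}"
      by (force simp: arcs_ends_conv)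
  qed
  then show ?thesis
    unfolding out_degree_def rel_degree_def by (rule bij_betw_same_card)
qed

text \<open>Restoring the ends turns interior lists into paths. With \<open>0 < t\<close> there is
  at least one path, so \<open>u\<close> and \<open>v\<close> are covered as well.\<close>

lemma (in wf_digraph) one_to_one_disjoint_path_coverableI:
  assumes "\<And>u v. u \<in> verts G \<Longrightarrow> v \<in> verts G \<Longrightarrow> u \<noteq> v
    \<Longrightarrow> \<exists>I. path_cover (\<lambda>a b. a \<rightarrow>\<^bsub>G\<^esub> b) (verts G) u v I \<and> card I = t"
    and "0 < t"
  shows "one_to_one_disjoint_path_coverable t G"
  unfolding one_to_one_disjoint_path_coverable_def
proof (intro ballI impI)
  fix u v assume uv: "u \<in> verts G" "v \<in> verts G" "u \<noteq> v"
  then obtain I where I: "path_cover (\<lambda>a b. a \<rightarrow>\<^bsub>G\<^esub> b) (verts G) u v I" "card I = t"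
    using assms by blast
  then have part: "path_partition (verts G) u v I" by (simp add: path_cover_def)
  let ?f = "\<lambda>L. u # L @ [v]"
  have sub: "set L \<subseteq> verts G" if "L \<in> I" for L
  proof -
    have "set L \<subseteq> (\<Union>L\<in>I. set L)" using that by blast
    then show ?thesis using part by (auto simp: path_partition_def)
  qed
  have arcs: "set (vwalk_arcs p) \<subseteq> arcs_ends G" if "successively (\<lambda>a b. a \<rightarrow>\<^bsub>G\<^esub> b) p" for p
    using that by (induction p rule: vwalk_arcs.induct) auto
  have path: "vpath (?f L) G \<and> hd (?f L) = u \<and> last (?f L) = v" if L: "L \<in> I" for L
  proof -
    have "successively (\<lambda>a b. a \<rightarrow>\<^bsub>G\<^esub> b) (?f L)" using I(1) L by (simp add: path_cover_def)
    moreover have "distinct (?f L)" using path_partition_memD[OF part L] uv(3) by auto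
    ultimately show ?thesis using arcs[of "?f L"] sub[OF L] uv by (simp add: vpath_def vwalk_def)
  qed
  have "I \<noteq> {}" using I(2) assms(2) by auto
  have cover: "\<exists>p\<in>?f ` I. w \<in> set p" if w: "w \<in> verts G" for w
  proof (cases "w \<in> {u, v}")
    case True
    then show ?thesis using \<open>I \<noteq> {}\<close> by auto
  next
    case False
    then have "w \<in> (\<Union>L\<in>I. set L)" using part w by (simp add: path_partition_def)
    then show ?thesis by auto
  qed
  have "set L \<inter> set M = {}" if "L \<in> I" "M \<in> I" "L \<noteq> M" for L M
    using part that by (simp add: path_partition_def)
  then have "\<forall>p\<in>?f ` I. \<forall>q\<in>?f ` I. p \<noteq> q \<longrightarrow> set p \<inter> set q = {u, v}" by fastforce
  moreover have "finite (?f ` I)" using part by (simp add: path_partition_def)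
  moreover have "card (?f ` I) = t" using I(2) by (subst card_image) (auto simp: inj_on_def)
  ultimately show "\<exists>P. finite P \<and> card P = t \<and> (\<forall>p\<in>P. vpath p G \<and> hd p = u \<and> last p = v) \<and>
      (\<forall>w\<in>verts G. \<exists>p\<in>P. w \<in> set p) \<and> (\<forall>p\<in>P. \<forall>q\<in>P. p \<noteq> q \<longrightarrow> set p \<inter> set q = {u, v})"
    using path cover by (intro exI[of _ "?f ` I"]) blast
qed

theorem corollary2p4:
  fixes G :: "('a, 'b) pre_digraph" and n t \<delta> :: nat and \<alpha> :: real
  assumes "n \<ge> 3"
    and "2 \<le> t" and "t \<le> \<delta>" and "\<delta> \<le> hbound n t"
    and "0 \<le> \<alpha>" and "\<alpha> < 1"
    and "graph G" and "connected G"
    and "card (verts G) = n"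
    and "min_degree G = \<delta>"
    and "alpha_spectral_radius \<alpha> G >
      ((real \<delta> + \<alpha> * real n - \<alpha> * real \<delta> - 1)
        + sqrt ((real \<delta> + \<alpha> * real n - \<alpha> * real \<delta> - 1)\<^sup>2
                + 4 * (1 - \<alpha>) * (2 * real (h2 n t \<delta>) - real n * real \<delta> + real \<delta>))) / 2"
  shows "one_to_one_disjoint_path_coverable t G"
proof -
  interpret graph G by fact
  let ?R = "\<lambda>a b. a \<rightarrow>\<^bsub>G\<^esub> b" and ?V = "verts G"
  let ?d = "rel_degree ?R ?V"
  have R: "symp ?R" "irreflp ?R"
    using sym_arcs no_loops by (auto simp: symp_def symmetric_def sym_def irreflp_def arcs_ends_conv)
  have n: "card ?V = n" by fact
  have V: "finite ?V" "?V \<noteq> {}" using assms(1) n by auto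
  have \<delta>_def: "\<delta> = Min (?d ` ?V)"
    using assms(10) unfolding min_degree_def by (simp add: out_degree_eq_rel_degree[abs_def])
  then have \<delta>: "\<delta> \<le> ?d v" if "v \<in> ?V" for v using V that by simp
  have "\<delta> \<in> ?d ` ?V" unfolding \<delta>_def using V by (intro Min_in) auto
  then obtain v0 where v0: "v0 \<in> ?V" "?d v0 = \<delta>" by auto
  let ?A = "A_alpha_mat \<alpha> G"
  let ?vs = "vertex_list G"
  have len: "length ?vs = n"
    using vertex_list[OF V(1)] n distinct_card by metis
  have A: "?A \<in> carrier_mat n n"
    by (auto simp: A_alpha_mat_def degree_mat_def adjacency_mat_def Let_def len)
  have "?A $$ (i, j) = ?A $$ (j, i)" if "i < n" "j < n" for i j
    using that R(1) by (auto simp: A_alpha_mat_def degree_mat_def adjacency_mat_def Let_def len dest: sympD)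
  then have "\<exists>\<mu>. eigenvalue ?A \<mu>"
    using assms(1) by (intro real_symmetric_mat_has_eigenvalue[OF A]) auto
  \<comment> \<open>The maximum of a finite nonempty set belongs to it, so the spectral radius is
    itself an eigenvalue.\<close>
  then have "alpha_spectral_radius \<alpha> G \<in> {\<mu>. eigenvalue ?A \<mu>}"
    unfolding alpha_spectral_radius_def using finite_eigenvalues[OF A] by (intro Max_in) auto
  then obtain x where x: "\<exists>v\<in>?V. x v \<noteq> 0"
    "\<And>v. v \<in> ?V \<Longrightarrow> \<alpha> * real (?d v) * x v + (1 - \<alpha>) * (\<Sum>w\<in>?V. of_bool (?R v w) * x w)
      = alpha_spectral_radius \<alpha> G * x v"
    unfolding mem_Collect_eq eigenvalue_A_alpha_mat_iff[OF V(1)] out_degree_eq_rel_degree of_bool_def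
    by blast
  \<comment> \<open>Otherwise \<open>A_alpha_eigenvalue_le\<close>, with
    \<open>2 * h2 n t \<delta>\<close> in place of the degree sum in \<open>K\<close>, contradicts
    the spectral hypothesis.\<close>
  have many: "2 * h2 n t \<delta> < (\<Sum>v\<in>?V. ?d v)"
  proof (rule ccontr)
    assume "\<not> ?thesis"
    then have "real (\<Sum>v\<in>?V. ?d v) \<le> 2 * real (h2 n t \<delta>)"
      by (metis linorder_not_less of_nat_le_iff of_nat_mult of_nat_numeral)
    then have "(1 - \<alpha>) * (real (\<Sum>v\<in>?V. ?d v) - real (card ?V) * real \<delta> + real \<delta>)
        \<le> (1 - \<alpha>) * (2 * real (h2 n t \<delta>) - real n * real \<delta> + real \<delta>)"
      using assms(6) n by (intro mult_left_mono) auto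
    then have "alpha_spectral_radius \<alpha> G \<le>
      ((real \<delta> + \<alpha> * real n - \<alpha> * real \<delta> - 1)
        + sqrt ((real \<delta> + \<alpha> * real n - \<alpha> * real \<delta> - 1)\<^sup>2
                + 4 * ((1 - \<alpha>) * (2 * real (h2 n t \<delta>) - real n * real \<delta> + real \<delta>)))) / 2"
      using assms(2,3) n by (intro A_alpha_eigenvalue_le[OF R V(1) _ \<delta> assms(5,6) _ _ x]) auto
    then show False using assms(11) unfolding mult.assoc by linarith
  qed
  \<comment> \<open>From \<open>t \<le> hbound n t\<close> it follows that
    \<open>2 * t \<le> n + t - 3\<close>, so \<open>t \<le> n - 3\<close>.\<close>
  have "t < n" using assms(1,3,4) by (auto simp: hbound_def)
  have "\<exists>I. path_cover ?R ?V u v I \<and> card I = t" if "u \<in> ?V" "v \<in> ?V" "u \<noteq> v" for u v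
    using path_cover_if_low_degrees_rare[OF R V(1) that assms(2)] \<open>t < n\<close> n
      low_degrees_rare[OF R V(1) n assms(2,3) \<delta> v0 many] by blast
  then show ?thesis using assms(2) by (intro one_to_one_disjoint_path_coverableI) auto
qed

end
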